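(* Let $\mathcal{F}$ be a family of distribution functions on $\mathbf{R}$ such that (i) each element of $\mathcal{F}$ is strictly increasing and continuous; (ii) there exists a point $x_*\in\mathbf{R}$ such that $F_1(x_* )\neq F_2(x_* )$ for each different $F_1,F_2\in\mathcal{F}$. Put $\Theta=\{F(x_* ):F\in\mathcal{F}\}$ and, for $\theta=F(x_* )\in\Theta$, put $F_\theta=F$, so that $\mathcal{F}=\{F_\theta:\theta\in\Theta\}$. Let $\mu_\theta$ be the Borel probability measure on $\mathbf{R}$ defined by $F_\theta$. Fix $\theta_0\in\Theta$. For $(x_k)_{k\in\mathbb{N}}\in\mathbf{R}^{\mathbb{N}}$ put $$\widetilde{T_n}((x_k)_{k\in\mathbb{N}})=n^{-1}\,\#(\{x_1,\dots,x_n\}\cap(-\infty;x_*]),\qquad \underline{\lim}\,\widetilde{T_n}=\sup_n\inf_{m\ge n}\widetilde{T_m},$$ and define $T^{(2)}_{\theta_0}:\mathbf{R}^{\mathbb{N}}\to\Theta$ by $T^{(2)}_{\theta_0}((x_k)_{k\in\mathbb{N}})=\underline{\lim}\,\widetilde{T_n}((x_k)_{k\in\mathbb{N}})$ if $\underline{\lim}\,\widetilde{T_n}((x_k)_{k\in\mathbb{N}})\in\Theta\setminus\{\theta_0\}$, and $T^{(2)}_{\theta_0}((x_k)_{k\in\mathbb{N}})=\theta_0$ otherwise. Then $T^{(2)}_{\theta_0}$ is an objective infinite sample consistent estimator of the parameter $\theta$ for the family $(\mu_\theta^{\mathbb{N}})_{\theta\in\Theta}$.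
   Context: $\mathbf{R}^{\mathbb{N}}$ is the topological vector space of all real sequences with the Tychonoff (product) metric $\rho((x_k),(y_k))=\sum_k |x_k-y_k|/(2^k(1+|x_k-y_k|))$, and $\mathcal{B}(\mathbf{R}^{\mathbb{N}})$ is its Borel $\sigma$-algebra. $\mu^{\mathbb{N}}=\mu\times\mu\times\cdots$ is the infinite power of $\mu$. $\#$ denotes counting measure. Infinite sample consistent estimate: let $L(\Theta)$ be the minimal $\sigma$-algebra of subsets of $\Theta$ generated by all singletons. A $(\mathcal{B}(\mathbf{R}^{\mathbb{N}}),L(\Theta))$-measurable function $T:\mathbf{R}^{\mathbb{N}}\to\Theta$ is an infinite sample consistent estimate (estimator) of $\theta$ for $(\mu_\theta^{\mathbb{N}})_{\theta\in\Theta}$ if $\mu_\theta^{\mathbb{N}}(\{(x_k)_{k\in\mathbb{N}}:T((x_k)_{k\in\mathbb{N}})=\theta\})=1$ for each $\theta\in\Theta$. It is called objective if $T^{-1}(\theta)$ is a Haar ambivalent set for each $\theta\in\Theta$. Haar ambivalent: let $V$ be a complete metric linear space. A measure on $V$ is a nonnegative, not identically zero measure on the Borel sets. A measure $\mu$ is transverse to a Borel set $S\subset V$ if there is a compact $U\subset V$ with $0<\mu(U)<1$ and $\mu(S+v)=0$ for every $v\in V$. A Borel set is shy if some measure is transverse to it; a subset of $V$ is shy if it is contained in a shy Borel set. The complement of a shy set is prevalent. A set is Haar ambivalent if it is neither shy nor prevalent.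
   Formalization: Two hypotheses are added, each necessary for the conclusion: the family has at least two different elements (otherwise the only fibre is all of R^N, which is prevalent), and Θ is a Borel subset of R (otherwise the estimator is not measurable). *)

theory Defs
  imports "HOL-Probability.Probability" "HOL-Library.Function_Algebras"
begin

section \<open>Complete metric linear spaces\<close>

class complete_metric_linear_space =
  real_vector + complete_space + topological_ab_group_add +
  assumes tendsto_scaleR_Pair:
    "LIM p (nhds r \<times>\<^sub>F nhds v). fst p *\<^sub>R snd p :> nhds (r *\<^sub>R v)"

text \<open>
  The library gives \<^typ>\<open>nat \<Rightarrow> real\<close> the product topology, with a complete metric inducing it. That
  metric is not the series with terms |x_k - y_k| / (2^k (1 + |x_k - y_k|)), but it induces the same
  topology, and all notions below (compact set, Borel set, translate) depend on the topology and
  the linear structure only.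
\<close>

instantiation "fun" :: (type, real_vector) real_vector
begin

definition scaleR_fun :: "real \<Rightarrow> ('a \<Rightarrow> 'b) \<Rightarrow> 'a \<Rightarrow> 'b" where
  "r *\<^sub>R f = (\<lambda>x. r *\<^sub>R f x)"

instance
  by standard (simp_all add: scaleR_fun_def fun_eq_iff scaleR_add_right scaleR_add_left)

end

lemma tendsto_fun_iff:
  fixes f :: "'c \<Rightarrow> 'a \<Rightarrow> 'b::topological_space"
  shows "(f \<longlongrightarrow> l) F \<longleftrightarrow> (\<forall>i. ((\<lambda>p. f p i) \<longlongrightarrow> l i) F)"
  using limitin_componentwise[of "\<lambda>_. euclidean" UNIV f l F]
  unfolding euclidean_product_topology by simp

lemmas tendsto_fun_coordinatewise = tendsto_fun_iff[THEN iffD2, rule_format]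
  and tendsto_fun_apply = tendsto_fun_iff[THEN iffD1, rule_format]

instance "fun" :: (type, topological_monoid_add) topological_monoid_add
proof
  fix a b :: "'a \<Rightarrow> 'b"
  show "LIM p (nhds a \<times>\<^sub>F nhds b). fst p + snd p :> nhds (a + b)"
  proof (rule tendsto_fun_coordinatewise)
    fix i
    have "((\<lambda>p. fst p i) \<longlongrightarrow> a i) (nhds a \<times>\<^sub>F nhds b)"
      by (rule tendsto_fun_apply[OF filterlim_fst])
    moreover have "((\<lambda>p. snd p i) \<longlongrightarrow> b i) (nhds a \<times>\<^sub>F nhds b)"
      by (rule tendsto_fun_apply[OF filterlim_snd])
    ultimately show "((\<lambda>p. (fst p + snd p) i) \<longlongrightarrow> (a + b) i) (nhds a \<times>\<^sub>F nhds b)"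
      unfolding plus_fun_apply by (rule tendsto_add)
  qed
qed

instance "fun" :: (type, topological_group_add) topological_group_add
proof
  fix a :: "'a \<Rightarrow> 'b"
  show "(uminus \<longlongrightarrow> - a) (nhds a)"
  proof (rule tendsto_fun_coordinatewise)
    fix i
    have "((\<lambda>f. f i) \<longlongrightarrow> a i) (nhds a)"
      by (rule tendsto_fun_apply[OF filterlim_ident])
    then show "((\<lambda>f. (- f) i) \<longlongrightarrow> (- a) i) (nhds a)"
      unfolding uminus_apply by (rule tendsto_minus)
  qed
qed

instance "fun" :: (type, topological_ab_group_add) topological_ab_group_add ..

instance "fun" :: (countable, complete_metric_linear_space) complete_metric_linear_space
proof
  fix r :: real and v :: "'a \<Rightarrow> 'b"
  show "LIM p (nhds r \<times>\<^sub>F nhds v). fst p *\<^sub>R snd p :> nhds (r *\<^sub>R v)"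
  proof (rule tendsto_fun_coordinatewise)
    fix i
    have "((\<lambda>p. snd p i) \<longlongrightarrow> v i) (nhds r \<times>\<^sub>F nhds v)"
      by (rule tendsto_fun_apply[OF filterlim_snd])
    then have "LIM p (nhds r \<times>\<^sub>F nhds v). (fst p, snd p i) :> nhds r \<times>\<^sub>F nhds (v i)"
      by (intro filterlim_Pair filterlim_fst)
    from filterlim_compose[OF tendsto_scaleR_Pair this]
    show "((\<lambda>p. (fst p *\<^sub>R snd p) i) \<longlongrightarrow> (r *\<^sub>R v) i) (nhds r \<times>\<^sub>F nhds v)"
      by (simp add: scaleR_fun_def)
  qed
qed

instance real :: complete_metric_linear_space
proof
  fix r v :: real
  show "LIM p (nhds r \<times>\<^sub>F nhds v). fst p *\<^sub>R snd p :> nhds (r *\<^sub>R v)"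
    by (intro tendsto_scaleR filterlim_fst filterlim_snd)
qed


section \<open>Haar ambivalent sets\<close>

definition nonzero_borel_measure :: "'a::topological_space measure \<Rightarrow> bool" where
  "nonzero_borel_measure \<mu> \<longleftrightarrow> sets \<mu> = sets borel \<and> emeasure \<mu> UNIV \<noteq> 0"

definition transverse :: "'a::complete_metric_linear_space measure \<Rightarrow> 'a set \<Rightarrow> bool" where
  "transverse \<mu> S \<longleftrightarrow>
     (\<exists>U. compact U \<and> 0 < emeasure \<mu> U \<and> emeasure \<mu> U < 1) \<and>
     (\<forall>v. emeasure \<mu> ((\<lambda>s. s + v) ` S) = 0)"

definition shy_borel :: "'a::complete_metric_linear_space set \<Rightarrow> bool" where
  "shy_borel S \<longleftrightarrow> S \<in> sets borel \<and> (\<exists>\<mu>. nonzero_borel_measure \<mu> \<and> transverse \<mu> S)"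

definition shy :: "'a::complete_metric_linear_space set \<Rightarrow> bool" where
  "shy S \<longleftrightarrow> (\<exists>B. shy_borel B \<and> S \<subseteq> B)"

definition prevalent :: "'a::complete_metric_linear_space set \<Rightarrow> bool" where
  "prevalent S \<longleftrightarrow> shy (- S)"

definition haar_ambivalent :: "'a::complete_metric_linear_space set \<Rightarrow> bool" where
  "haar_ambivalent S \<longleftrightarrow> \<not> shy S \<and> \<not> prevalent S"


section \<open>Infinite sample consistent estimators\<close>

definition singleton_algebra :: "'p set \<Rightarrow> 'p measure" where
  "singleton_algebra \<Theta> = sigma \<Theta> ((\<lambda>\<theta>. {\<theta>}) ` \<Theta>)"

definition infinite_power :: "real measure \<Rightarrow> (nat \<Rightarrow> real) measure" where
  "infinite_power \<mu> = (\<Pi>\<^sub>M k\<in>UNIV. \<mu>)"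

text \<open>Measurability into the singleton algebra includes that \<open>T\<close> takes its values in \<open>\<Theta>\<close>.\<close>

definition infinite_sample_consistent_estimator ::
    "'p set \<Rightarrow> ('p \<Rightarrow> real measure) \<Rightarrow> ((nat \<Rightarrow> real) \<Rightarrow> 'p) \<Rightarrow> bool" where
  "infinite_sample_consistent_estimator \<Theta> \<mu> T \<longleftrightarrow>
     T \<in> borel \<rightarrow>\<^sub>M singleton_algebra \<Theta> \<and>
     (\<forall>\<theta>\<in>\<Theta>. emeasure (infinite_power (\<mu> \<theta>)) {x. T x = \<theta>} = 1)"

definition objective_infinite_sample_consistent_estimator ::
    "'p set \<Rightarrow> ('p \<Rightarrow> real measure) \<Rightarrow> ((nat \<Rightarrow> real) \<Rightarrow> 'p) \<Rightarrow> bool" where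
  "objective_infinite_sample_consistent_estimator \<Theta> \<mu> T \<longleftrightarrow>
     infinite_sample_consistent_estimator \<Theta> \<mu> T \<and>
     (\<forall>\<theta>\<in>\<Theta>. haar_ambivalent {x. T x = \<theta>})"


section \<open>Families of distribution functions separated at a point\<close>

definition distribution_function :: "(real \<Rightarrow> real) \<Rightarrow> bool" where
  "distribution_function F \<longleftrightarrow>
     mono F \<and> (\<forall>a. continuous (at_right a) F) \<and> (F \<longlongrightarrow> 0) at_bot \<and> (F \<longlongrightarrow> 1) at_top"

definition parameter_set :: "(real \<Rightarrow> real) set \<Rightarrow> real \<Rightarrow> real set" where
  "parameter_set \<F> c = {F c |F. F \<in> \<F>}"

definition parameter_cdf :: "(real \<Rightarrow> real) set \<Rightarrow> real \<Rightarrow> real \<Rightarrow> (real \<Rightarrow> real)" where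
  "parameter_cdf \<F> c \<theta> = (THE F. F \<in> \<F> \<and> F c = \<theta>)"

definition parameter_law :: "(real \<Rightarrow> real) set \<Rightarrow> real \<Rightarrow> real \<Rightarrow> real measure" where
  "parameter_law \<F> c \<theta> = interval_measure (parameter_cdf \<F> c \<theta>)"

text \<open>
  Sequences are indexed from 0, so the first \<open>n\<close> terms form the set \<open>x ` {..<n}\<close>; it is counted as a
  set, that is, repeated values count once.
\<close>

definition freq_le :: "real \<Rightarrow> nat \<Rightarrow> (nat \<Rightarrow> real) \<Rightarrow> real" where
  "freq_le c n x = real (card (x ` {..<n} \<inter> {..c})) / real n"

definition lower_freq :: "real \<Rightarrow> (nat \<Rightarrow> real) \<Rightarrow> real" where
  "lower_freq c x = (SUP n\<in>{1..}. INF m\<in>{n..}. freq_le c m x)"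

definition lower_freq_estimator :: "real set \<Rightarrow> real \<Rightarrow> real \<Rightarrow> (nat \<Rightarrow> real) \<Rightarrow> real" where
  "lower_freq_estimator \<Theta> \<theta>\<^sub>0 c x =
     (if lower_freq c x \<in> \<Theta> - {\<theta>\<^sub>0} then lower_freq c x else \<theta>\<^sub>0)"

end

theory Submission
  imports Defs
begin

text \<open>
  Consistency is the strong law of large numbers. Under the infinite power of a law without atoms the
  terms of a sequence are almost surely pairwise distinct, so that counting the set of the first
  \<open>n\<close> terms below \<open>c\<close> is the same as counting indices, and \<open>freq_le c n\<close> is the average of
  \<open>n\<close> independent indicators of mean \<open>cdf N c\<close>. Hence \<open>lower_freq c\<close> is almost surely equal to the
  parameter (\<open>AE_lower_freq_eq_cdf\<close>). The strong law for bounded variables follows from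
  Hoeffding's inequality and the Borel-Cantelli lemma.

  For objectivity, a set that contains a translate of every compact set is not shy, because a measure
  transverse to it would give a translate, hence some compact set of positive measure, measure zero.
  Given a parameter \<open>t \<in> [0, 1]\<close> and a compact set \<open>K\<close> of sequences, the \<open>k\<close>-th coordinate
  is bounded on \<open>K\<close>, and a translation can move its range to any place on the line. Move
  these ranges into pairwise disjoint intervals, to the left of \<open>c\<close> for the indices \<open>k\<close> in a set of
  asymptotic density \<open>t\<close> and to the right of it otherwise. All the translated sequences are then
  injective with frequencies tending to \<open>t\<close> (\<open>compact_translate_lower_freq\<close>). So no fibre of the
  estimator is shy. No fibre is prevalent either: there are two different parameters, so the
  complement of a fibre contains another fibre.
\<close>

section \<open>The strong law of large numbers for bounded variables\<close>

text \<open>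
  By Hoeffding's inequality the probability that the average of \<open>n\<close> terms deviates from the mean by
  a fixed \<open>\<epsilon>\<close> decays geometrically in \<open>n\<close>, so that the Borel-Cantelli lemma applies.
\<close>

lemma (in prob_space) strong_law_bounded_iid:
  fixes X :: "nat \<Rightarrow> 'a \<Rightarrow> real"
  assumes indep: "indep_vars (\<lambda>_. borel) X UNIV"
    and distr: "\<And>i. distr M borel (X i) = distr M borel (X 0)"
    and bounded: "AE \<omega> in M. X 0 \<omega> \<in> {a..b}" and "a < b"
  shows "AE \<omega> in M. (\<lambda>n. (\<Sum>i<n. X i \<omega>) / real n) \<longlonglongrightarrow> expectation (X 0)"
proof -
  have [measurable]: "random_variable borel (X i)" for i
    using indep unfolding indep_vars_def by blast
  define dev where "dev n \<omega> = \<bar>(\<Sum>i<n. X i \<omega>) / real n - expectation (X 0)\<bar>" for n \<omega>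
  have [measurable]: "random_variable borel (dev n)" for n
    unfolding dev_def by measurable
  have tail: "prob {\<omega> \<in> space M. \<epsilon> \<le> dev n \<omega>} \<le> 2 * exp (- 2 * \<epsilon>\<^sup>2 / (b - a)\<^sup>2) ^ n"
    if "0 < \<epsilon>" "0 < n" for \<epsilon> n
  proof -
    have "prob {\<omega> \<in> space M. \<bar>(\<Sum>i<n. X i \<omega>) / real (card {..<n}) - expectation (X 0)\<bar> \<ge> \<epsilon>}
        \<le> 2 * exp (- 2 * real (card {..<n}) * \<epsilon>\<^sup>2 / (b - a)\<^sup>2)"
    proof -
      interpret Hoeffding_ineq_iid M "{..<n}" X "X 0" a b "expectation (X 0)"
        by unfold_locales
           (rule finite_lessThan indep_vars_subset[OF indep subset_UNIV] distr bounded | simp)+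
      have "{..<n} \<noteq> {}" using \<open>0 < n\<close> by blast
      then show ?thesis
        using \<open>0 < \<epsilon>\<close> \<open>a < b\<close> by (intro Hoeffding_ineq_abs_ge' less_imp_le)
    qed
    moreover have "exp (- 2 * \<epsilon>\<^sup>2 / (b - a)\<^sup>2) ^ n = exp (- 2 * real n * \<epsilon>\<^sup>2 / (b - a)\<^sup>2)"
      by (simp add: mult_ac flip: exp_of_nat_mult)
    ultimately show ?thesis
      by (simp add: dev_def)
  qed
  \<comment> \<open>For a fixed tolerance the tails are summable; countably many tolerances suffice for convergence.\<close>
  have "AE \<omega> in M. \<forall>k. \<forall>\<^sub>F n in sequentially. dev n \<omega> < inverse (real (Suc k))"
  proof (subst AE_all_countable, intro allI)
    fix k
    define \<epsilon> where "\<epsilon> = inverse (real (Suc k))"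
    have "\<epsilon> > 0" by (simp add: \<epsilon>_def)
    have "exp (- 2 * \<epsilon>\<^sup>2 / (b - a)\<^sup>2) < 1"
      using \<open>\<epsilon> > 0\<close> \<open>a < b\<close> by (simp add: divide_neg_pos)
    then have "summable (\<lambda>n. 2 * exp (- 2 * \<epsilon>\<^sup>2 / (b - a)\<^sup>2) ^ n)"
      by (intro summable_mult summable_geometric) simp
    then have "summable (\<lambda>n. prob {\<omega> \<in> space M. \<epsilon> \<le> dev n \<omega>})"
      by (rule summable_comparison_test'[where N = 1]) (use tail[OF \<open>\<epsilon> > 0\<close>] in simp)
    then have "AE \<omega> in M. \<forall>\<^sub>F n in sequentially. \<omega> \<in> space M - {\<omega> \<in> space M. \<epsilon> \<le> dev n \<omega>}"
      by (intro borel_cantelli_AE1) (auto simp: less_top[symmetric])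
    then show "AE \<omega> in M. \<forall>\<^sub>F n in sequentially. dev n \<omega> < \<epsilon>"
      by (rule AE_mp) (simp add: not_le)
  qed
  then show ?thesis
  proof eventually_elim
    fix \<omega> assume *: "\<forall>k. \<forall>\<^sub>F n in sequentially. dev n \<omega> < inverse (real (Suc k))"
    show "(\<lambda>n. (\<Sum>i<n. X i \<omega>) / real n) \<longlonglongrightarrow> expectation (X 0)"
    proof (rule tendstoI)
      fix e :: real assume "e > 0"
      then obtain k where k: "inverse (real (Suc k)) < e"
        using reals_Archimedean by blast
      show "\<forall>\<^sub>F n in sequentially. dist ((\<Sum>i<n. X i \<omega>) / real n) (expectation (X 0)) < e"
        unfolding dist_real_def
        by (rule eventually_mono[OF *[rule_format, of k, unfolded dev_def]]) (use k in linarith)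
    qed
  qed
qed

section \<open>Independent samples from a law without atoms\<close>

lemma (in prob_space) indep_vars_coordinates:
  "prob_space.indep_vars (\<Pi>\<^sub>M i\<in>UNIV. M) (\<lambda>_. M) (\<lambda>i x. x i) (UNIV :: 'i set)"
proof -
  interpret P: prob_space "\<Pi>\<^sub>M i\<in>(UNIV::'i set). M"
    by (rule prob_space_PiM) (rule prob_space_axioms)
  have "distr (\<Pi>\<^sub>M i\<in>(UNIV::'i set). M) M (\<lambda>x. x i) = M" for i
    by (rule distr_PiM_component) (auto intro: prob_space_axioms)
  then show ?thesis
    by (subst P.indep_vars_iff_distr_eq_PiM') (auto simp: restrict_def)
qed

text \<open>
  The joint law of two different coordinates is the product of the law with itself, and each
  vertical section of the diagonal is a single point, hence a null set. By Fubini's theorem the diagonal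
  is a null set, and there are only countably many pairs of indices.
\<close>

lemma AE_coordinates_inj:
  fixes N :: "real measure"
  assumes "prob_space N" and [measurable_cong, simp]: "sets N = sets borel"
    and atomless: "\<And>a. measure N {a} = 0"
  shows "AE x in \<Pi>\<^sub>M i\<in>(UNIV::nat set). N. inj x"
proof -
  interpret N: prob_space N by fact
  interpret P: prob_space "\<Pi>\<^sub>M i\<in>(UNIV::nat set). N"
    by (rule prob_space_PiM) (rule assms(1))
  interpret NN: pair_sigma_finite N N ..
  let ?P = "\<Pi>\<^sub>M i\<in>(UNIV::nat set). N"
  have dist: "distr ?P borel (\<lambda>x. x i) = N" for i
  proof -
    have "distr ?P borel (\<lambda>x. x i) = distr ?P N (\<lambda>x. x i)"
      by (rule distr_cong) auto
    also have "\<dots> = N"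
      by (rule distr_PiM_component) (auto intro: N.prob_space_axioms)
    finally show ?thesis .
  qed
  have "AE x in ?P. x i \<noteq> x j" if "i \<noteq> j" for i j
  proof -
    have "P.indep_vars (\<lambda>_. borel) (\<lambda>i x. x i) (insert i {j})"
      by (rule P.indep_vars_subset[OF P.indep_vars_compose2[OF N.indep_vars_coordinates]]) auto
    \<comment> \<open>The sum over the one-element index set \<open>{j}\<close> is the \<open>j\<close>-th coordinate.\<close>
    from P.indep_vars_sum[OF _ _ this] that
    have "P.indep_var borel (\<lambda>x. x i) borel (\<lambda>x. x j)" by simp
    then have joint: "N \<Otimes>\<^sub>M N = distr ?P (borel \<Otimes>\<^sub>M borel) (\<lambda>x. (x i, x j))"
      unfolding P.indep_var_distribution_eq dist by simp
    have "AE b in N. a \<noteq> b" for a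
      using atomless[of a] by (intro AE_I[of _ _ "{a}"]) (auto simp: N.emeasure_eq_measure)
    moreover have "fst \<in> borel_measurable (N \<Otimes>\<^sub>M N)" "snd \<in> borel_measurable (N \<Otimes>\<^sub>M N)"
      by measurable
    ultimately have "AE p in N \<Otimes>\<^sub>M N. fst p \<noteq> snd p"
      by (intro NN.AE_pair_measure borel_measurable_neq) auto
    then show ?thesis
      unfolding joint by (subst (asm) AE_distr_iff) auto
  qed
  then have "AE x in ?P. \<forall>i j. i \<noteq> j \<longrightarrow> x i \<noteq> x j"
    by (simp add: AE_all_countable)
  then show ?thesis
    by eventually_elim (auto simp: inj_def)
qed

section \<open>Frequencies and their lower limit\<close>

text \<open>
  The set \<open>x ` {..<n}\<close> counts a repeated value once; charging each value to its first occurrence turns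
  the cardinality into a sum of indicators of Borel sets.
\<close>

lemma freq_le_eq:
  "freq_le c n x = (\<Sum>i<n. if x i \<le> c \<and> (\<forall>j\<in>{..<i}. x j \<noteq> x i) then 1 else 0) / real n"
proof -
  define first where "first = {i. i < n \<and> x i \<le> c \<and> (\<forall>j\<in>{..<i}. x j \<noteq> x i)}"
  have "inj_on x first"
    by (rule linorder_inj_onI') (auto simp: first_def)
  moreover have "x ` first = x ` {..<n} \<inter> {..c}"
  proof (intro equalityI subsetI)
    fix y assume y: "y \<in> x ` {..<n} \<inter> {..c}"
    define i where "i = (LEAST i. x i = y)"
    from y obtain k where "k < n" "x k = y" by auto
    then have "i \<le> k" "x i = y" unfolding i_def by (auto intro: LeastI Least_le)
    moreover have "x j \<noteq> y" if "j < i" for j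
      using that not_less_Least unfolding i_def by blast
    ultimately show "y \<in> x ` first"
      using y \<open>k < n\<close> unfolding first_def by auto
  qed (auto simp: first_def)
  ultimately have "card (x ` {..<n} \<inter> {..c}) = card first"
    using card_image by metis
  moreover have "(\<Sum>i<n. if x i \<le> c \<and> (\<forall>j\<in>{..<i}. x j \<noteq> x i) then 1 else 0) = real (card first)"
    by (auto simp: first_def sum.If_cases intro!: arg_cong[where f=card])
  ultimately show ?thesis
    by (simp add: freq_le_def)
qed

lemma freq_le_inj:
  assumes "inj x"
  shows "freq_le c n x = (\<Sum>i<n. indicator {..c} (x i)) / real n"
proof -
  have "freq_le c n x = real (card (x ` {i. i < n \<and> x i \<le> c})) / real n"
    by (auto simp: freq_le_def intro!: arg_cong[where f = card])
  also have "card (x ` {i. i < n \<and> x i \<le> c}) = card {i. i < n \<and> x i \<le> c}"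
    by (rule card_image) (rule inj_on_subset[OF assms subset_UNIV])
  also have "real \<dots> = (\<Sum>i<n. indicator {..c} (x i))"
    by (simp add: indicator_def sum.If_cases Int_def)
  finally show ?thesis .
qed

lemma freq_le_nonneg: "0 \<le> freq_le c n x"
  by (simp add: freq_le_def)

lemma freq_le_le_1: "freq_le c n x \<le> 1"
proof -
  have "card (x ` {..<n} \<inter> {..c}) \<le> card (x ` {..<n})"
    by (intro card_mono) auto
  also have "\<dots> \<le> n"
    using card_image_le[of "{..<n}" x] by simp
  finally show ?thesis
    by (simp add: freq_le_def divide_le_eq)
qed

lemma bdd_below_freq_le: "bdd_below ((\<lambda>m. freq_le c m x) ` A)"
  by (rule bdd_belowI2[of _ 0]) (rule freq_le_nonneg)

lemma bdd_above_INF_freq_le: "bdd_above ((\<lambda>n. INF m\<in>{n..}. freq_le c m x) ` A)"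
proof (rule bdd_aboveI2)
  fix n
  show "(INF m\<in>{n..}. freq_le c m x) \<le> 1"
    by (rule cINF_lower2[OF bdd_below_freq_le, of n]) (auto intro: freq_le_le_1)
qed

lemma lower_freq_eq_limit:
  assumes "(\<lambda>n. freq_le c n x) \<longlonglongrightarrow> l"
  shows "lower_freq c x = l"
proof (rule antisym)
  show "lower_freq c x \<le> l"
    unfolding lower_freq_def
  proof (rule cSUP_least)
    fix n :: nat
    show "(INF m\<in>{n..}. freq_le c m x) \<le> l"
      by (rule LIMSEQ_le_const[OF assms], rule exI[of _ n])
         (auto intro!: cINF_lower bdd_below_freq_le)
  qed auto
  show "l \<le> lower_freq c x"
  proof (rule field_le_epsilon)
    fix e :: real assume "e > 0"
    with assms have "\<forall>\<^sub>F n in sequentially. l - e < freq_le c n x"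
      by (intro order_tendstoD) auto
    then obtain N where N: "\<And>n. n \<ge> N \<Longrightarrow> l - e < freq_le c n x"
      by (auto simp: eventually_sequentially)
    have "l - e \<le> (INF m\<in>{Suc N..}. freq_le c m x)"
      by (rule cINF_greatest) (auto intro!: less_imp_le N)
    also have "\<dots> \<le> lower_freq c x"
      unfolding lower_freq_def by (intro cSUP_upper bdd_above_INF_freq_le) auto
    finally show "l \<le> lower_freq c x + e" by simp
  qed
qed

lemma borel_measurable_freq_le: "freq_le c n \<in> borel_measurable borel"
proof -
  have coord: "(\<lambda>x::nat \<Rightarrow> real. x i) \<in> borel_measurable borel" for i
    by (intro borel_measurable_continuous_onI continuous_on_product_coordinates)
  have eq: "Measurable.pred (borel :: (nat \<Rightarrow> real) measure) (\<lambda>x. x j = x i)" for i j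
    unfolding pred_def by (rule borel_measurable_eq[OF coord coord])
  have le: "Measurable.pred (borel :: (nat \<Rightarrow> real) measure) (\<lambda>x. x i \<le> c)" for i
    unfolding pred_def by (rule borel_measurable_le[OF coord borel_measurable_const])
  have "(\<lambda>x. (\<Sum>i<n. if x i \<le> c \<and> (\<forall>j\<in>{..<i}. x j \<noteq> x i) then 1 else 0) / real n)
          \<in> borel_measurable (borel :: (nat \<Rightarrow> real) measure)"
    by (intro borel_measurable_divide borel_measurable_sum borel_measurable_const measurable_If
        predE pred_intros_logic pred_intros_finite finite_lessThan eq le)
  then show ?thesis
    unfolding freq_le_eq[abs_def] .
qed

lemma borel_measurable_lower_freq [measurable]: "lower_freq c \<in> borel_measurable borel"
  unfolding lower_freq_def[abs_def]
  by (intro borel_measurable_cSUP borel_measurable_cINF bdd_below_freq_le bdd_above_INF_freq_le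
      borel_measurable_freq_le) auto

lemma AE_lower_freq_eq_cdf:
  fixes N :: "real measure"
  assumes "prob_space N" and [measurable_cong, simp]: "sets N = sets borel"
    and atomless: "\<And>a. measure N {a} = 0"
  shows "AE x in infinite_power N. lower_freq c x = cdf N c"
proof -
  interpret N: prob_space N by fact
  interpret P: prob_space "infinite_power N"
    unfolding infinite_power_def by (rule prob_space_PiM) (rule assms(1))
  have [simp]: "space N = UNIV"
    using sets_eq_imp_space_eq[of N borel] by simp
  define X :: "nat \<Rightarrow> (nat \<Rightarrow> real) \<Rightarrow> real" where "X i x = indicator {..c} (x i)" for i x
  have marginal: "distr (infinite_power N) N (\<lambda>x. x i) = N" for i
    unfolding infinite_power_def by (rule distr_PiM_component) (auto intro: assms(1))
  have coord [measurable]: "(\<lambda>x. x i) \<in> infinite_power N \<rightarrow>\<^sub>M N" for i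
    unfolding infinite_power_def by (rule measurable_component_singleton) simp
  have ind [measurable]: "(indicator {..c} :: real \<Rightarrow> real) \<in> borel_measurable N"
    by measurable
  have indep: "P.indep_vars (\<lambda>_. borel) X UNIV"
    unfolding X_def infinite_power_def
    by (rule prob_space.indep_vars_compose2[OF _ N.indep_vars_coordinates])
       (use ind P.prob_space_axioms in \<open>simp_all add: infinite_power_def\<close>)
  have "distr (infinite_power N) borel (X i) = distr N borel (indicator {..c})" for i
    using distr_distr[OF ind coord, of i] by (simp add: marginal X_def[abs_def] comp_def)
  then have same: "distr (infinite_power N) borel (X i) = distr (infinite_power N) borel (X 0)" for i
    by simp
  have "P.expectation (X 0) = (\<integral>x. indicator {..c} x \<partial>distr (infinite_power N) N (\<lambda>x. x 0))"
    unfolding X_def by (rule integral_distr[symmetric]) (rule coord ind)+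
  then have "P.expectation (X 0) = cdf N c"
    by (simp add: marginal cdf_def)
  moreover have "AE x in infinite_power N. X 0 x \<in> {0..1}"
    by (simp add: X_def)
  ultimately have "AE x in infinite_power N. (\<lambda>n. (\<Sum>i<n. X i x) / real n) \<longlonglongrightarrow> cdf N c"
    using P.strong_law_bounded_iid[OF indep same, of 0 1] by simp
  moreover have "AE x in infinite_power N. inj x"
    unfolding infinite_power_def using assms by (rule AE_coordinates_inj)
  ultimately show ?thesis
    by eventually_elim (rule lower_freq_eq_limit, simp add: freq_le_inj X_def)
qed

section \<open>Sets that are not shy\<close>

lemma borel_translate:
  fixes B :: "'a::topological_group_add set"
  assumes "B \<in> sets borel"
  shows "(\<lambda>s. s + v) ` B \<in> sets borel"
proof -
  have "(\<lambda>s. s + v) ` B = (\<lambda>s. s + - v) -` B"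
  proof (intro equalityI subsetI)
    fix x assume "x \<in> (\<lambda>s. s + - v) -` B"
    then show "x \<in> (\<lambda>s. s + v) ` B"
      by (intro image_eqI[of _ _ "x + - v"]) (simp_all add: add.assoc)
  qed (auto simp: add.assoc)
  then have "(\<lambda>s. s + v) ` B = (\<lambda>s. s + - v) -` B \<inter> space borel"
    by simp
  also have "\<dots> \<in> sets borel"
    by (intro measurable_sets[OF _ assms] borel_measurable_continuous_onI
        continuous_on_add continuous_on_id continuous_on_const)
  finally show ?thesis .
qed

text \<open>
  A transverse measure is positive on some compact set \<open>K\<close>. If \<open>K + v \<subseteq> S\<close>, then the translate by
  \<open>- v\<close> of any set containing \<open>S\<close> contains \<open>K\<close> and cannot be null.
\<close>

lemma not_shy_if_contains_translates_of_compacts: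
  fixes S :: "'a::complete_metric_linear_space set"
  assumes "\<And>K. compact K \<Longrightarrow> \<exists>v. (\<lambda>s. s + v) ` K \<subseteq> S"
  shows "\<not> shy S"
proof
  assume "shy S"
  then obtain B \<mu> where B: "S \<subseteq> B" "B \<in> sets borel" "sets \<mu> = sets borel"
    and transverse: "transverse \<mu> B"
    unfolding shy_def shy_borel_def nonzero_borel_measure_def by blast
  then obtain K where K: "compact K" "0 < emeasure \<mu> K"
    unfolding transverse_def by blast
  from assms[OF K(1)] obtain v where v: "(\<lambda>s. s + v) ` K \<subseteq> S" by blast
  have "K \<subseteq> (\<lambda>s. s + - v) ` B"
  proof
    fix s assume "s \<in> K"
    then have "s + v \<in> B" using v B(1) by blast
    then show "s \<in> (\<lambda>s. s + - v) ` B" by (rule rev_image_eqI) (simp add: add.assoc)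
  qed
  then have "emeasure \<mu> K \<le> emeasure \<mu> ((\<lambda>s. s + - v) ` B)"
    by (rule emeasure_mono) (use borel_translate[OF B(2), of "- v"] in \<open>simp only: B(3)\<close>)
  also have "\<dots> = 0"
    using transverse unfolding transverse_def by blast
  finally show False using K(2) by simp
qed

lemma shy_mono: "shy S \<Longrightarrow> R \<subseteq> S \<Longrightarrow> shy R"
  unfolding shy_def by blast

section \<open>Translating compact sets of sequences to a prescribed frequency\<close>

lemma tendsto_floor_mult_divide:
  fixes t :: real
  shows "(\<lambda>n. of_int \<lfloor>real n * t\<rfloor> / real n) \<longlonglongrightarrow> t"
proof (rule tendsto_sandwich)
  have "\<forall>\<^sub>F n in sequentially. n > (0::nat)" by (rule eventually_gt_at_top)
  then show "\<forall>\<^sub>F n in sequentially. t - inverse (real n) \<le> of_int \<lfloor>real n * t\<rfloor> / real n"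
  proof eventually_elim
    fix n :: nat assume "n > 0"
    then have "t - inverse (real n) = (real n * t - 1) / real n" by (simp add: field_simps)
    also have "\<dots> \<le> of_int \<lfloor>real n * t\<rfloor> / real n"
      by (intro divide_right_mono) linarith+
    finally show "t - inverse (real n) \<le> of_int \<lfloor>real n * t\<rfloor> / real n" .
  qed
  show "\<forall>\<^sub>F n in sequentially. of_int \<lfloor>real n * t\<rfloor> / real n \<le> t"
    using eventually_gt_at_top[of "0::nat"] by eventually_elim (simp add: divide_le_eq mult.commute)
  show "(\<lambda>n. t - inverse (real n)) \<longlonglongrightarrow> t"
    using tendsto_diff[OF tendsto_const[of t] lim_inverse_n] by simp
qed simp

text \<open>
  The indices \<open>i\<close> at which \<open>\<lfloor>i t\<rfloor>\<close> jumps form a set of density \<open>t\<close>: as \<open>0 \<le> t \<le> 1\<close>,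
  each jump has height one, so the number of jumps before \<open>n\<close> is \<open>\<lfloor>n t\<rfloor>\<close>.
\<close>

lemma set_of_density:
  fixes t :: real
  assumes "0 \<le> t" "t \<le> 1"
  obtains A :: "nat set" where "(\<lambda>n. (\<Sum>i<n. indicator A i) / real n) \<longlonglongrightarrow> t"
proof
  let ?A = "{i. \<lfloor>real i * t\<rfloor> < \<lfloor>real (Suc i) * t\<rfloor>}"
  have step: "indicator ?A i = (of_int \<lfloor>real (Suc i) * t\<rfloor> - of_int \<lfloor>real i * t\<rfloor> :: real)" for i
  proof -
    have "real (Suc i) * t = real i * t + t" by (simp add: algebra_simps)
    with assms have "\<lfloor>real i * t\<rfloor> \<le> \<lfloor>real (Suc i) * t\<rfloor>" "\<lfloor>real (Suc i) * t\<rfloor> \<le> \<lfloor>real i * t\<rfloor> + 1"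
      by linarith+
    then show ?thesis by (auto simp: indicator_def)
  qed
  have "(\<Sum>i<n. indicator ?A i) = (of_int \<lfloor>real n * t\<rfloor> :: real)" for n
    unfolding step by (subst sum_lessThan_telescope) simp
  then show "(\<lambda>n. (\<Sum>i<n. indicator ?A i) / real n) \<longlonglongrightarrow> t"
    using tendsto_floor_mult_divide[of t] by simp
qed

lemma compact_translate_lower_freq:
  assumes "compact K" "0 \<le> t" "t \<le> 1"
  shows "\<exists>v. (\<lambda>s. s + v) ` K \<subseteq> {x. lower_freq c x = t}"
proof -
  have "\<exists>M>0. \<forall>x\<in>K. \<bar>x k\<bar> < M" for k
  proof -
    have "bounded ((\<lambda>x. x k) ` K)"
      using \<open>compact K\<close>
      by (intro compact_imp_bounded compact_continuous_image
          continuous_on_subset[OF continuous_on_product_coordinates subset_UNIV])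
    then obtain b where b: "\<forall>x\<in>K. \<bar>x k\<bar> \<le> b"
      by (auto simp: bounded_iff)
    show ?thesis by (rule exI[of _ "max 0 b + 1"]) (use b in force)
  qed
  then obtain M where M: "\<And>k. M k > 0" "\<And>k x. x \<in> K \<Longrightarrow> \<bar>x k\<bar> < M k" by metis
  obtain A where A: "(\<lambda>n. (\<Sum>i<n. indicator A i) / real n) \<longlonglongrightarrow> t"
    using set_of_density assms by blast
  \<comment> \<open>The \<open>k\<close>-th coordinate, ranging over an open interval of length \<open>2 * M k\<close>, is put at a distance
    strictly between \<open>S k\<close> and \<open>S (Suc k)\<close> from \<open>c\<close>; different distances make the terms distinct,
    on whichever side of \<open>c\<close> they lie.\<close>
  define S where "S k = (\<Sum>j<k. 2 * M j)" for k
  define v where "v k = (if k \<in> A then c - (S k + M k) else c + (S k + M k))" for k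
  have S_Suc: "S (Suc k) = S k + 2 * M k" for k by (simp add: S_def)
  have S: "0 \<le> S k" for k
    unfolding S_def using M(1) by (intro sum_nonneg) (simp add: less_imp_le)
  have "strict_mono S"
    by (rule strict_monoI_Suc) (simp add: S_Suc M)
  have "lower_freq c (x + v) = t" if "x \<in> K" for x
  proof -
    have "S k < \<bar>(x + v) k - c\<bar> \<and> \<bar>(x + v) k - c\<bar> < S (Suc k)" for k
      using M(2)[OF that, of k] S[of k] by (auto simp: v_def S_Suc)
    moreover have "(x + v) k \<le> c \<longleftrightarrow> k \<in> A" for k
      using M(2)[OF that, of k] S[of k] by (auto simp: v_def)
    moreover have "inj (x + v)"
    proof (rule linorder_injI)
      fix i j :: nat assume "i < j"
      then have "S (Suc i) \<le> S j"
        using \<open>strict_mono S\<close> by (simp add: strict_mono_less_eq)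
      with calculation(1)[of i] calculation(1)[of j] show "(x + v) i \<noteq> (x + v) j"
        by auto
    qed
    ultimately show ?thesis
      by (intro lower_freq_eq_limit) (use A in \<open>simp add: freq_le_inj indicator_def\<close>)
  qed
  then show ?thesis by blast
qed

section \<open>The estimator\<close>

lemma interval_measure_continuous:
  assumes "distribution_function F" "continuous_on UNIV F"
  shows "real_distribution (interval_measure F)"
    and "cdf (interval_measure F) = F"
    and "measure (interval_measure F) {a} = 0"
proof -
  have F: "\<And>x y. x \<le> y \<Longrightarrow> F x \<le> F y" "\<And>a. continuous (at_right a) F"
      "(F \<longlongrightarrow> 0) at_bot" "(F \<longlongrightarrow> 1) at_top"
    using assms(1) by (auto simp: distribution_function_def mono_def)
  interpret real_distribution "interval_measure F"
    using F by (rule real_distribution_interval_measure)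
  show "real_distribution (interval_measure F)" by unfold_locales
  show cdf: "cdf (interval_measure F) = F"
    using F(1-3) by (rule cdf_interval_measure)
  have "isCont F a"
    using assms(2) by (simp add: continuous_on_eq_continuous_at)
  then show "measure (interval_measure F) {a} = 0"
    using isCont_cdf[of a] cdf by simp
qed

lemma sets_infinite_power: "sets N = sets borel \<Longrightarrow> sets (infinite_power N) = sets borel"
  unfolding infinite_power_def by (simp cong: sets_PiM_cong add: sets_PiM_equal_borel)

lemma measurable_lower_freq_estimator:
  assumes "\<Theta> \<in> sets borel" "\<theta>\<^sub>0 \<in> \<Theta>"
  shows "lower_freq_estimator \<Theta> \<theta>\<^sub>0 c \<in> borel \<rightarrow>\<^sub>M singleton_algebra \<Theta>"
  unfolding singleton_algebra_def
proof (rule measurable_measure_of)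
  have [measurable]: "\<Theta> \<in> sets borel" by fact
  have *: "lower_freq_estimator \<Theta> \<theta>\<^sub>0 c \<in> borel_measurable borel"
    unfolding lower_freq_estimator_def[abs_def] by measurable
  show "lower_freq_estimator \<Theta> \<theta>\<^sub>0 c -` A \<inter> space borel \<in> sets borel"
    if "A \<in> (\<lambda>\<theta>. {\<theta>}) ` \<Theta>" for A
    using that measurable_sets[OF *, of A] by auto
qed (use assms in \<open>auto simp: lower_freq_estimator_def\<close>)

lemma parameter_law_eq:
  assumes "inj_on (\<lambda>F. F c) \<F>" "F \<in> \<F>"
  shows "parameter_law \<F> c (F c) = interval_measure F"
proof -
  have "parameter_cdf \<F> c (F c) = F"
    unfolding parameter_cdf_def using assms by (intro the_equality) (auto dest: inj_onD)
  then show ?thesis by (simp add: parameter_law_def)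
qed

lemma lower_freq_estimator_eq:
  "\<theta> \<in> \<Theta> \<Longrightarrow> lower_freq c x = \<theta> \<Longrightarrow> lower_freq_estimator \<Theta> \<theta>\<^sub>0 c x = \<theta>"
  by (simp add: lower_freq_estimator_def)

lemma not_shy_fibre_lower_freq_estimator:
  assumes "\<theta> \<in> \<Theta>" "0 \<le> \<theta>" "\<theta> \<le> 1"
  shows "\<not> shy {x. lower_freq_estimator \<Theta> \<theta>\<^sub>0 c x = \<theta>}"
proof -
  have "{x. lower_freq c x = \<theta>} \<subseteq> {x. lower_freq_estimator \<Theta> \<theta>\<^sub>0 c x = \<theta>}"
    using assms(1) by (auto intro: lower_freq_estimator_eq)
  then show ?thesis
    using not_shy_if_contains_translates_of_compacts[OF compact_translate_lower_freq[OF _ assms(2,3)]] shy_mono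
    by blast
qed

theorem theorem3p5:
  fixes \<F> :: "(real \<Rightarrow> real) set" and x\<^sub>s \<theta>\<^sub>0 :: real
  assumes "\<And>F. F \<in> \<F> \<Longrightarrow> distribution_function F"
    and "\<And>F. F \<in> \<F> \<Longrightarrow> strict_mono F \<and> continuous_on UNIV F"
    and "\<And>F\<^sub>1 F\<^sub>2. F\<^sub>1 \<in> \<F> \<Longrightarrow> F\<^sub>2 \<in> \<F> \<Longrightarrow> F\<^sub>1 \<noteq> F\<^sub>2 \<Longrightarrow> F\<^sub>1 x\<^sub>s \<noteq> F\<^sub>2 x\<^sub>s"
    and "\<theta>\<^sub>0 \<in> parameter_set \<F> x\<^sub>s"
    and at_least_two: "\<exists>F\<^sub>1\<in>\<F>. \<exists>F\<^sub>2\<in>\<F>. F\<^sub>1 \<noteq> F\<^sub>2"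
    and borel_parameters: "parameter_set \<F> x\<^sub>s \<in> sets borel"
  shows "objective_infinite_sample_consistent_estimator
           (parameter_set \<F> x\<^sub>s)
           (parameter_law \<F> x\<^sub>s)
           (lower_freq_estimator (parameter_set \<F> x\<^sub>s) \<theta>\<^sub>0 x\<^sub>s)"
proof -
  define \<Theta> where "\<Theta> = parameter_set \<F> x\<^sub>s"
  define T where "T = lower_freq_estimator \<Theta> \<theta>\<^sub>0 x\<^sub>s"
  have inj: "inj_on (\<lambda>F. F x\<^sub>s) \<F>"
    using assms(3) by (auto simp: inj_on_def)
  have meas: "T \<in> borel \<rightarrow>\<^sub>M singleton_algebra \<Theta>"
    unfolding T_def using assms(4) borel_parameters
    by (intro measurable_lower_freq_estimator) (simp_all add: \<Theta>_def)
  have consistent: "emeasure (infinite_power (parameter_law \<F> x\<^sub>s \<theta>)) {x. T x = \<theta>} = 1"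
    and bounds: "0 \<le> \<theta> \<and> \<theta> \<le> 1" if \<theta>: "\<theta> \<in> \<Theta>" for \<theta>
  proof -
    obtain F where F: "F \<in> \<F>" "\<theta> = F x\<^sub>s"
      using \<theta> by (auto simp: \<Theta>_def parameter_set_def)
    let ?N = "interval_measure F"
    have dist: "distribution_function F" "continuous_on UNIV F"
      using assms(1,2) F(1) by auto
    note law = interval_measure_continuous[OF dist]
    interpret N: real_distribution ?N by (rule law)
    have cdf: "cdf ?N x\<^sub>s = \<theta>" by (simp add: law F(2))
    show "0 \<le> \<theta> \<and> \<theta> \<le> 1"
      using N.cdf_nonneg[of x\<^sub>s] N.cdf_bounded_prob[of x\<^sub>s] cdf by simp
    interpret P: prob_space "infinite_power ?N"
      unfolding infinite_power_def by (rule prob_space_PiM) (rule N.prob_space_axioms)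
    have "AE x in infinite_power ?N. lower_freq x\<^sub>s x = cdf ?N x\<^sub>s"
      by (intro AE_lower_freq_eq_cdf N.prob_space_axioms) (simp_all add: law)
    then have "AE x in infinite_power ?N. x \<in> {x. T x = \<theta>}"
      by eventually_elim (use that cdf in \<open>simp add: T_def lower_freq_estimator_eq\<close>)
    moreover have "{x. T x = \<theta>} \<in> sets (infinite_power ?N)"
    proof -
      have "{\<theta>} \<in> sets (singleton_algebra \<Theta>)"
        using that by (auto simp: singleton_algebra_def)
      from measurable_sets[OF meas this] show ?thesis
        by (simp add: sets_infinite_power vimage_def)
    qed
    ultimately show "emeasure (infinite_power (parameter_law \<F> x\<^sub>s \<theta>)) {x. T x = \<theta>} = 1"
      unfolding F(2) parameter_law_eq[OF inj F(1)] by (intro P.emeasure_eq_1_AE)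
  qed
  have not_shy: "\<not> shy {x. T x = \<theta>}" if "\<theta> \<in> \<Theta>" for \<theta>
    unfolding T_def using that bounds by (intro not_shy_fibre_lower_freq_estimator) auto
  have "haar_ambivalent {x. T x = \<theta>}" if "\<theta> \<in> \<Theta>" for \<theta>
  proof -
    obtain F\<^sub>1 F\<^sub>2 where "F\<^sub>1 \<in> \<F>" "F\<^sub>2 \<in> \<F>" "F\<^sub>1 \<noteq> F\<^sub>2"
      using at_least_two by blast
    then have "F\<^sub>1 x\<^sub>s \<noteq> F\<^sub>2 x\<^sub>s" "F\<^sub>1 x\<^sub>s \<in> \<Theta>" "F\<^sub>2 x\<^sub>s \<in> \<Theta>"
      using assms(3) by (auto simp: \<Theta>_def parameter_set_def)
    then obtain \<theta>' where \<theta>': "\<theta>' \<in> \<Theta>" "\<theta>' \<noteq> \<theta>" by metis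
    then have "{x. T x = \<theta>'} \<subseteq> - {x. T x = \<theta>}" by auto
    with not_shy[OF \<theta>'(1)] have "\<not> shy (- {x. T x = \<theta>})"
      using shy_mono by blast
    with not_shy[OF that] show ?thesis
      by (simp add: haar_ambivalent_def prevalent_def)
  qed
  with meas consistent show ?thesis
    unfolding objective_infinite_sample_consistent_estimator_def
      infinite_sample_consistent_estimator_def T_def \<Theta>_def by blast
qed

end
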